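(* Let $\lambda_1>\mu_1$ be positive integers and let $r(\lambda_1,\mu_1)=\min\{z\in\mathbb{N}: z\ge\lambda_1,\ \gcd(z,\mu_1)=1\}$. Then the pair $(\lambda_1,\mu_1)$ is $r(\lambda_1,\mu_1)$-initial. In particular, $(\lambda_1,\mu_1)$ is $(\lambda_1+\mu_1-1)$-initial.
   Context: For a positive integer $r$, a partition with at most $r$ parts is written as a non-increasing $r$-tuple of nonnegative integers; $\mathrm{Par}_r(n)$ is the set of such tuples with entries summing to $n$. For $\lambda,\mu\in\mathrm{Par}_r(n)$, $\lambda$ dominates $\mu$ if $\sum_{i=1}^k\lambda_i\ge\sum_{i=1}^k\mu_i$ for all $k\le r$. The $r$-Kostka cone $\mathcal{K}_r\subseteq\mathbb{R}^{2r}$ is the convex hull of all points $(\lambda_1,\dots,\lambda_r,\mu_1,\dots,\mu_r)$ with $\lambda,\mu\in\mathrm{Par}_r(n)$ for some $n$ and $\lambda$ dominating $\mu$; it is a pointed rational polyhedral cone. Its Hilbert basis is the unique minimal finite set of integer points of $\mathcal{K}_r$ such that every integer point of $\mathcal{K}_r$ is a nonnegative integer combination of them; equivalently, the set of integer points of $\mathcal{K}_r$ that are not nonnegative integer combinations of other integer points of $\mathcal{K}_r$. An integer pair $(\lambda_1,\mu_1)$ is called $r$-initial if there is an element $(\lambda,\mu)$ of the Hilbert basis of $\mathcal{K}_r$ such that the first entry of $\lambda$ is $\lambda_1$ and the first entry of $\mu$ is $\mu_1$. *)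

theory Defs
  imports "HOL-Analysis.Analysis" "HOL-Analysis.Finite_Function_Topology"
begin

definition Par :: "nat \<Rightarrow> nat \<Rightarrow> nat list set" where
  "Par r n = {l. length l = r \<and> sorted_wrt (\<ge>) l \<and> sum_list l = n}"

definition dominates :: "nat list \<Rightarrow> nat list \<Rightarrow> bool" where
  "dominates l m \<longleftrightarrow> (\<forall>k \<le> length l. sum_list (take k l) \<ge> sum_list (take k m))"

text \<open>
  Since the dimension \<open>2 * r\<close> has to vary with a natural number, it cannot be a type. The space
  \<open>\<real>\<^bsup>2r\<^esup> = \<real>\<^bsup>r\<^esup> \<times> \<real>\<^bsup>r\<^esup>\<close> is realised as the subspace of the real vector space below consisting
  of pairs whose components vanish at all indices \<open>\<ge> r\<close>. Coordinates are numbered from \<open>0\<close>, so the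
  first entry of \<open>\<lambda>\<close> has index \<open>0\<close>.
\<close>

type_synonym rvec_pair = "(nat \<Rightarrow>\<^sub>0 real) \<times> (nat \<Rightarrow>\<^sub>0 real)"

definition tuple_vec :: "nat list \<Rightarrow> nat \<Rightarrow>\<^sub>0 real" where
  "tuple_vec l = Poly_Mapping.nth (map real l)"

definition kostka_cone :: "nat \<Rightarrow> rvec_pair set" where
  "kostka_cone r =
     convex hull {(tuple_vec l, tuple_vec m) | l m n. l \<in> Par r n \<and> m \<in> Par r n \<and> dominates l m}"

definition integer_points :: "rvec_pair set \<Rightarrow> rvec_pair set" where
  "integer_points K =
     {x \<in> K. \<forall>i. Poly_Mapping.lookup (fst x) i \<in> \<int> \<and> Poly_Mapping.lookup (snd x) i \<in> \<int>}"

definition nat_combinations :: "'a::real_vector set \<Rightarrow> 'a set" where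
  "nat_combinations A = {\<Sum>x\<in>S. real (c x) *\<^sub>R x | S (c :: 'a \<Rightarrow> nat). finite S \<and> S \<subseteq> A}"

text \<open>The origin is excluded from the Hilbert basis, being the empty combination.\<close>

definition hilbert_basis :: "rvec_pair set \<Rightarrow> rvec_pair set" where
  "hilbert_basis K =
     {x \<in> integer_points K. x \<notin> nat_combinations (integer_points K - {x})}"

definition initial_pair :: "nat \<Rightarrow> int \<Rightarrow> int \<Rightarrow> bool" where
  "initial_pair r a b \<longleftrightarrow>
     (\<exists>(l, m) \<in> hilbert_basis (kostka_cone r).
        Poly_Mapping.lookup l 0 = real_of_int a \<and> Poly_Mapping.lookup m 0 = real_of_int b)"

definition r_fun :: "nat \<Rightarrow> nat \<Rightarrow> nat" where
  "r_fun a b = (LEAST z. z \<ge> a \<and> gcd z b = 1)"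

end

theory Submission
  imports Defs
begin

text \<open>
  Let \<open>r\<close> be coprime to \<open>\<mu>\<^sub>1\<close> with \<open>\<lambda>\<^sub>1 \<le> r < \<lambda>\<^sub>1 + \<mu>\<^sub>1\<close>. The generator with
  \<open>\<lambda> = (\<lambda>\<^sub>1\<^bsup>\<mu>\<^sub>1\<^esup>)\<close> and \<open>\<mu> = (\<mu>\<^sub>1\<^bsup>r - \<mu>\<^sub>1\<^esup>, (\<lambda>\<^sub>1 + \<mu>\<^sub>1 - r)\<^bsup>\<mu>\<^sub>1\<^esup>)\<close>, padded with zeros, is
  indecomposable: a summand is constant wherever the whole is, so it has the form
  \<open>(a\<^bsup>\<mu>\<^sub>1\<^esup>)\<close>, \<open>(p\<^bsup>r - \<mu>\<^sub>1\<^esup>, q\<^bsup>\<mu>\<^sub>1\<^esup>)\<close>, and comparing sizes gives \<open>\<mu>\<^sub>1 dvd p * r\<close>, hence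
  \<open>p = 0\<close> or \<open>p = \<mu>\<^sub>1\<close>. Thus one of the two summands has first \<open>\<mu>\<close>-entry \<open>0\<close>, which forces it to
  vanish. Among the numbers \<open>z\<close> with \<open>\<lambda>\<^sub>1 \<le> z < \<lambda>\<^sub>1 + \<mu>\<^sub>1\<close> one is congruent to \<open>1\<close> modulo \<open>\<mu>\<^sub>1\<close>, so the
  minimal \<open>r\<close> of the theorem satisfies these bounds.
\<close>

lemma lookup_scaleR:
  "Poly_Mapping.lookup (c *\<^sub>R f) i = c * Poly_Mapping.lookup f i"
  for f :: "'a \<Rightarrow>\<^sub>0 real"
proof -
  have "finite {j. c *\<^sub>R Poly_Mapping.lookup f j \<noteq> 0}"
    by (rule finite_subset[OF _ finite_lookup[of f]]) auto
  then show ?thesis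
    by (simp add: scaleR_poly_mapping_def lookup_Abs_poly_mapping)
qed

text \<open>
  This cone contains the Kostka cone; dominance is dropped, since the generator is
  indecomposable even in the larger cone.
\<close>

definition antitone_pairs :: "nat \<Rightarrow> rvec_pair set" where
  "antitone_pairs R = {x.
     antimono (Poly_Mapping.lookup (fst x)) \<and> antimono (Poly_Mapping.lookup (snd x)) \<and>
     (\<forall>i. 0 \<le> Poly_Mapping.lookup (fst x) i \<and> 0 \<le> Poly_Mapping.lookup (snd x) i) \<and>
     (\<forall>i\<ge>R. Poly_Mapping.lookup (fst x) i = 0 \<and> Poly_Mapping.lookup (snd x) i = 0) \<and>
     (\<Sum>i<R. Poly_Mapping.lookup (fst x) i) = (\<Sum>i<R. Poly_Mapping.lookup (snd x) i)}"

lemma zero_in_antitone_pairs: "0 \<in> antitone_pairs R"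
  by (auto simp: antitone_pairs_def antimono_def)

lemma add_in_antitone_pairs:
  "x \<in> antitone_pairs R \<Longrightarrow> y \<in> antitone_pairs R \<Longrightarrow> x + y \<in> antitone_pairs R"
  by (auto simp: antitone_pairs_def antimono_def lookup_add sum.distrib intro: add_mono)

lemma scaleR_in_antitone_pairs:
  "0 \<le> c \<Longrightarrow> x \<in> antitone_pairs R \<Longrightarrow> c *\<^sub>R x \<in> antitone_pairs R"
  by (auto simp: antitone_pairs_def antimono_def lookup_scaleR mult_left_mono simp flip: sum_distrib_left)

lemma convex_antitone_pairs: "convex (antitone_pairs R)"
  by (intro convexI add_in_antitone_pairs scaleR_in_antitone_pairs) auto

lemma lookup_tuple_vec:
  "Poly_Mapping.lookup (tuple_vec l) i = (if i < length l then real (l ! i) else 0)"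
  by (simp add: tuple_vec_def nth.rep_eq nth_default_def)

lemma antimono_tuple_vec:
  assumes "sorted_wrt (\<ge>) l"
  shows "antimono (Poly_Mapping.lookup (tuple_vec l))"
proof (rule antimonoI)
  fix i j :: nat
  assume "i \<le> j"
  then show "Poly_Mapping.lookup (tuple_vec l) j \<le> Poly_Mapping.lookup (tuple_vec l) i"
    using assms by (cases "i = j") (auto simp: lookup_tuple_vec sorted_wrt_iff_nth_less)
qed

lemma sum_lookup_tuple_vec:
  "(\<Sum>i<length l. Poly_Mapping.lookup (tuple_vec l) i) = real (sum_list l)"
  by (simp add: lookup_tuple_vec sum_list_sum_nth atLeast0LessThan)

lemma kostka_cone_subset_antitone_pairs: "kostka_cone R \<subseteq> antitone_pairs R"
  unfolding kostka_cone_def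
proof (intro hull_minimal convex_antitone_pairs subsetI)
  fix x
  assume "x \<in> {(tuple_vec l, tuple_vec m) | l m n. l \<in> Par R n \<and> m \<in> Par R n \<and> dominates l m}"
  then obtain l m n where x: "x = (tuple_vec l, tuple_vec m)" and "l \<in> Par R n" "m \<in> Par R n"
    by auto
  then have "length l = R" "length m = R" "sorted_wrt (\<ge>) l" "sorted_wrt (\<ge>) m"
    "sum_list l = n" "sum_list m = n"
    by (auto simp: Par_def)
  then show "x \<in> antitone_pairs R"
    using sum_lookup_tuple_vec[of l] sum_lookup_tuple_vec[of m]
    by (simp add: antitone_pairs_def x antimono_tuple_vec) (simp add: lookup_tuple_vec)
qed

text \<open>Entries of the second component lie between 0 and its first entry, so all vanish. By the
  equal sums, the first component then has nonnegative entries adding up to 0.\<close>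

lemma antitone_pair_eq_0:
  assumes x: "x \<in> antitone_pairs R" and 0: "Poly_Mapping.lookup (snd x) 0 = 0"
  shows "x = 0"
proof -
  have snd0: "Poly_Mapping.lookup (snd x) i = 0" for i
  proof -
    have "antimono (Poly_Mapping.lookup (snd x))" "0 \<le> Poly_Mapping.lookup (snd x) i"
      using x by (auto simp: antitone_pairs_def)
    from antimonoD[OF this(1), of 0 i] this(2) 0 show ?thesis by simp
  qed
  then have "(\<Sum>i<R. Poly_Mapping.lookup (fst x) i) = 0"
    using x by (simp add: antitone_pairs_def)
  then have "\<forall>i<R. Poly_Mapping.lookup (fst x) i = 0"
    using x by (subst (asm) sum_nonneg_eq_0_iff) (auto simp: antitone_pairs_def)
  then have "Poly_Mapping.lookup (fst x) i = 0" for i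
    using x by (cases "i < R") (auto simp: antitone_pairs_def)
  with snd0 show ?thesis
    by (intro prod_eqI poly_mapping_eqI) auto
qed

text \<open>Passes from two summands to arbitrary combinations. The integer points of the larger
  cone are closed under sums and natural multiples, so what is left of a combination after removing
  one term is itself an admissible summand.\<close>

lemma indecomposable_in_hilbert_basis:
  fixes x :: rvec_pair
  assumes x: "x \<in> integer_points (kostka_cone R)" and "x \<noteq> 0"
    and indec: "\<And>y z. y \<in> integer_points (antitone_pairs R) \<Longrightarrow>
      z \<in> integer_points (antitone_pairs R) \<Longrightarrow> x = y + z \<Longrightarrow> y = 0 \<or> z = 0"
  shows "x \<in> hilbert_basis (kostka_cone R)"
proof -
  let ?D = "integer_points (antitone_pairs R)"
  have mult: "real n *\<^sub>R y \<in> ?D" if "y \<in> ?D" for n y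
    using that scaleR_in_antitone_pairs[of "real n" y R]
    by (auto simp: integer_points_def lookup_scaleR)
  have add: "y + z \<in> ?D" if "y \<in> ?D" "z \<in> ?D" for y z
    using that add_in_antitone_pairs[of y R z] by (auto simp: integer_points_def lookup_add)
  have False if comb: "x \<in> nat_combinations (integer_points (kostka_cone R) - {x})"
  proof -
    obtain S and c :: "rvec_pair \<Rightarrow> nat" where "finite S"
      and S: "S \<subseteq> integer_points (kostka_cone R) - {x}"
      and x_eq: "x = (\<Sum>y\<in>S. real (c y) *\<^sub>R y)"
      using comb unfolding nat_combinations_def mem_Collect_eq
      by (elim exE conjE) (rule that)
    have D: "y \<in> ?D" if "y \<in> S" for y
      using that S kostka_cone_subset_antitone_pairs by (auto simp: integer_points_def)
    have sum_D: "(\<Sum>y\<in>T. real (c y) *\<^sub>R y) \<in> ?D" if "T \<subseteq> S" for T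
      using finite_subset[OF that \<open>finite S\<close>] that
    proof (induction T rule: finite_induct)
      case empty
      show ?case by (simp add: integer_points_def zero_in_antitone_pairs)
    next
      case (insert y T)
      then show ?case by (simp add: add mult D)
    qed
    have "real (c y) *\<^sub>R y = 0" if y: "y \<in> S" for y
    proof (cases "c y")
      case (Suc n)
      \<comment> \<open>Exactly one copy of \<open>y\<close> is split off from its
        \<open>Suc n\<close> copies.\<close>
      let ?z = "real n *\<^sub>R y + (\<Sum>w\<in>S - {y}. real (c w) *\<^sub>R w)"
      have "x = y + ?z"
        using x_eq y \<open>finite S\<close> Suc by (simp add: sum.remove[of S y] algebra_simps)
      moreover have "?z \<in> ?D"
        by (intro add mult D sum_D y) auto
      ultimately have "y = 0 \<or> ?z = 0"
        using indec D[OF y] by blast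
      \<comment> \<open>The case \<open>?z = 0\<close> would give \<open>x = y\<close>, but
        \<open>S\<close> omits \<open>x\<close>; hence \<open>y = 0\<close>.\<close>
      then show ?thesis
        using \<open>x = y + ?z\<close> y S by auto
    qed simp
    then have "x = 0"
      unfolding x_eq by (rule sum.neutral[rule_format])
    with \<open>x \<noteq> 0\<close> show False ..
  qed
  with x show ?thesis
    by (auto simp: hilbert_basis_def)
qed

text \<open>Neither summand can increase from \<open>i\<close> to \<open>j\<close>, and their two
  drops add up to the drop of \<open>f\<close>, which is 0.\<close>

lemma antimono_summand_const:
  fixes f g h :: "nat \<Rightarrow> real"
  assumes "antimono g" "antimono h" "\<And>i. f i = g i + h i"
    and "i \<le> j" "f i = f j"
  shows "g i = g j"
  using assms(3)[of i] assms(3)[of j] antimonoD[OF assms(1,4)] antimonoD[OF assms(2,4)] assms(5)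
  by linarith

lemma sum_lessThan_step:
  fixes c :: real
  assumes "k \<le> R"
  shows "(\<Sum>i<R. if i < k then c else 0) = real k * c"
proof -
  have "{..<R} \<inter> {i. i < k} = {..<k}" using assms by auto
  then show ?thesis by (simp add: sum.If_cases)
qed

text \<open>Keeping \<open>R\<close> apart from \<open>r\<close> lets one generator, padded with
  zeros, serve both claims of the theorem.\<close>

lemma initial_pair_if_coprime:
  fixes a b r R :: nat
  assumes "0 < b" "b < a" "a \<le> r" "r < a + b" "coprime r b" "r \<le> R"
  shows "initial_pair R (int a) (int b)"
proof -
  define l where "l = replicate b a @ replicate (R - b) 0"
  define m where "m = replicate (r - b) b @ replicate b (a + b - r) @ replicate (R - r) 0"
  define x where "x = (tuple_vec l, tuple_vec m)"
  have len: "length l = R" "length m = R"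
    using assms by (auto simp: l_def m_def)
  have l_nth: "l ! i = (if i < b then a else 0)" if "i < R" for i
    using that by (auto simp: l_def nth_append)
  have m_nth: "m ! i = (if i < r - b then b else if i < r then a + b - r else 0)" if "i < R" for i
    using that assms by (auto simp: m_def nth_append)
  have fst_x: "Poly_Mapping.lookup (fst x) i = (if i < b then real a else 0)" for i
    using assms by (auto simp: x_def lookup_tuple_vec len l_nth)
  have snd_x: "Poly_Mapping.lookup (snd x) i =
      (if i < r - b then real b else if i < r then real (a + b - r) else 0)" for i
    using assms by (auto simp: x_def lookup_tuple_vec len m_nth)
  have "b * (r - b) + b * (a + b - r) = b * a"
    using assms by (simp flip: distrib_left)
  then have sums: "sum_list l = b * a" "sum_list m = b * a"
    by (auto simp: l_def m_def sum_list_replicate mult.commute)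
  have Par: "l \<in> Par R (b * a)" "m \<in> Par R (b * a)"
    using assms by (auto simp: Par_def len sums sorted_wrt_iff_nth_less l_nth m_nth)
  \<comment> \<open>Up to \<open>k = b\<close> the comparison is entrywise, since every entry of
    \<open>m\<close> is at most \<open>b < a\<close>; from there on the prefix of \<open>l\<close>
    already has the full sum.\<close>
  have "sum_list (take k m) \<le> sum_list (take k l)" if "k \<le> R" for k
  proof (cases "k \<le> b")
    case True
    have "sum_list (take k m) = (\<Sum>i<k. m ! i)"
      using that by (simp add: sum_list_sum_nth len atLeast0LessThan min_def)
    also have "\<dots> \<le> (\<Sum>i<k. l ! i)"
      using that True assms by (intro sum_mono) (auto simp: l_nth m_nth)
    also have "\<dots> = sum_list (take k l)"
      using that by (simp add: sum_list_sum_nth len atLeast0LessThan min_def)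
    finally show ?thesis .
  next
    case False
    have "sum_list (take k m) \<le> sum_list m"
      by (metis append_take_drop_id le_add1 sum_list_append)
    also have "\<dots> = sum_list (take k l)"
      using False by (simp add: sums) (simp add: l_def sum_list_replicate)
    finally show ?thesis .
  qed
  then have "dominates l m"
    by (simp add: dominates_def len)
  then have "x \<in> kostka_cone R"
    unfolding kostka_cone_def x_def using Par by (intro hull_inc) auto
  then have x_int: "x \<in> integer_points (kostka_cone R)"
    by (simp add: integer_points_def fst_x snd_x)
  have x_0: "Poly_Mapping.lookup (fst x) 0 = a" "Poly_Mapping.lookup (snd x) 0 = b"
    using assms by (auto simp: fst_x snd_x)
  then have "x \<noteq> 0"
    using assms by auto
  have "x \<in> hilbert_basis (kostka_cone R)"
  proof (rule indecomposable_in_hilbert_basis[OF x_int \<open>x \<noteq> 0\<close>])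
    fix y z
    assume y: "y \<in> integer_points (antitone_pairs R)"
      and z: "z \<in> integer_points (antitone_pairs R)" and x_eq: "x = y + z"
    have yC: "y \<in> antitone_pairs R" and zC: "z \<in> antitone_pairs R"
      using y z by (auto simp: integer_points_def)
    let ?f = "Poly_Mapping.lookup (fst y)" and ?g = "Poly_Mapping.lookup (snd y)"
    let ?f' = "Poly_Mapping.lookup (fst z)" and ?g' = "Poly_Mapping.lookup (snd z)"
    have fst_add: "Poly_Mapping.lookup (fst x) i = ?f i + ?f' i"
      and snd_add: "Poly_Mapping.lookup (snd x) i = ?g i + ?g' i" for i
      by (auto simp: x_eq lookup_add)
    have anti: "antimono ?f" "antimono ?f'" "antimono ?g" "antimono ?g'"
      and nonneg: "\<And>i. 0 \<le> ?f i" "\<And>i. 0 \<le> ?f' i" "\<And>i. 0 \<le> ?g i" "\<And>i. 0 \<le> ?g' i"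
      and eq: "(\<Sum>i<R. ?f i) = (\<Sum>i<R. ?g i)"
      using yC zC by (auto simp: antitone_pairs_def)
    \<comment> \<open>The indices \<open>0\<close> and \<open>r - b\<close> start the two nonzero
      blocks of \<open>m\<close>; \<open>l\<close> has a single nonzero block, starting at
      \<open>0\<close>.\<close>
    obtain u p q where upq: "?f 0 = real_of_int u" "?g 0 = real_of_int p"
      "?g (r - b) = real_of_int q"
      using y by (force simp: integer_points_def Ints_def)
    have f: "?f i = (if i < b then real_of_int u else 0)" for i
    proof (cases "i < b")
      case True
      then show ?thesis
        using antimono_summand_const[OF anti(1,2) fst_add, of 0 i] upq by (simp add: fst_x)
    next
      case False
      then show ?thesis
        using fst_add[of i] nonneg(1,2)[of i] by (simp add: fst_x)
    qed
    \<comment> \<open>The values are \<open>p\<close> on the first block and \<open>q\<close> on the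
      second. Superposing two steps that both start at \<open>0\<close> makes
      \<open>sum_lessThan_step\<close> applicable to each.\<close>
    have g: "?g i = (if i < r - b then real_of_int (p - q) else 0)
        + (if i < r then real_of_int q else 0)" for i
    proof -
      consider "i < r - b" | "r - b \<le> i" "i < r" | "r \<le> i" by linarith
      then show ?thesis
      proof cases
        case 1
        then show ?thesis
          using antimono_summand_const[OF anti(3,4) snd_add, of 0 i] upq by (simp add: snd_x)
      next
        case 2
        then show ?thesis
          using antimono_summand_const[OF anti(3,4) snd_add, of "r - b" i] upq
          by (simp add: snd_x)
      next
        case 3
        then show ?thesis
          using snd_add[of i] nonneg(3,4)[of i] by (auto simp: snd_x)
      qed
    qed
    have "real b * u = real (r - b) * (p - q) + real r * q"
      using eq assms
      by (simp only: f g sum.distrib) (simp add: sum_lessThan_step del: of_int_diff of_nat_diff)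
    also have "\<dots> = (real r - real b) * (p - q) + real r * q"
      using assms by (simp add: of_nat_diff)
    finally have "real_of_int (int b * u) = real_of_int ((int r - int b) * (p - q) + int r * q)"
      by simp
    then have "int b * u = (int r - int b) * (p - q) + int r * q"
      by (simp only: of_int_eq_iff)
    \<comment> \<open>Modulo \<open>b\<close> the factor \<open>int r - int b\<close> is
      \<open>int r\<close>, so the terms in \<open>q\<close> cancel and only
      \<open>int r * p\<close> survives.\<close>
    then have "int r * p = int b * (u + p - q)"
      by (simp add: algebra_simps)
    then have "int b dvd int r * p"
      by simp
    then have "int b dvd p"
      using \<open>coprime r b\<close> by (simp add: coprime_dvd_mult_right_iff coprime_commute)
    moreover have "0 \<le> p" "p \<le> int b"
      using upq(2) nonneg(3,4)[of 0] snd_add[of 0] x_0(2) by linarith+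
    ultimately have "p = 0 \<or> p = int b"
      using zdvd_imp_le[of "int b" p] by linarith
    then have "real_of_int p = 0 \<or> real_of_int p = real b"
      by auto
    then have "?g 0 = 0 \<or> ?g' 0 = 0"
      using upq(2) snd_add[of 0] x_0(2) by linarith
    then show "y = 0 \<or> z = 0"
      using antitone_pair_eq_0 yC zC by blast
  qed
  with x_0 show ?thesis
    unfolding initial_pair_def by (intro bexI[of _ x]) (auto split: prod.split)
qed

lemma ex_coprime_in_interval:
  fixes a b :: nat
  assumes "0 < b"
  shows "\<exists>z. a \<le> z \<and> z < a + b \<and> coprime z b"
proof -
  \<comment> \<open>The offset makes \<open>z\<close> congruent to 1 modulo \<open>b\<close>; taking
    \<open>b * a + 1\<close> in place of \<open>1\<close> keeps the subtraction of \<open>a\<close>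
    from truncating.\<close>
  define z where "z = a + (b * a + 1 - a) mod b"
  have "a + (b * a + 1 - a) = b * a + 1"
    using assms by (cases b) auto
  then have "z mod b = (b * a + 1) mod b"
    by (metis mod_add_right_eq z_def)
  then have "gcd z b = gcd (b * a + 1) b"
    by (metis gcd.commute gcd_red_nat)
  also have "\<dots> = 1"
    by (metis coprime_iff_gcd_eq_1 coprime_1_left gcd.commute gcd_add_mult mult.commute add.commute)
  finally have "coprime z b"
    by (simp add: coprime_iff_gcd_eq_1)
  then show ?thesis
    using assms by (intro exI[of _ z]) (auto simp: z_def)
qed

theorem theorem6p7:
  fixes lambda1 mu1 :: nat
  assumes "mu1 > 0" and "lambda1 > mu1"
  shows "initial_pair (r_fun lambda1 mu1) (int lambda1) (int mu1)
       \<and> initial_pair (lambda1 + mu1 - 1) (int lambda1) (int mu1)"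
proof -
  let ?P = "\<lambda>z. z \<ge> lambda1 \<and> gcd z mu1 = 1"
  obtain z where z: "?P z" "z < lambda1 + mu1"
    using ex_coprime_in_interval[OF assms(1)] by (auto simp: coprime_iff_gcd_eq_1)
  have "?P (r_fun lambda1 mu1)"
    unfolding r_fun_def by (rule LeastI[of ?P, OF z(1)])
  \<comment> \<open>With \<open>z < lambda1 + mu1\<close> this yields both the strict bound required
    of \<open>r\<close> and \<open>r \<le> R\<close> for
    \<open>R = lambda1 + mu1 - 1\<close>.\<close>
  moreover have "r_fun lambda1 mu1 \<le> z"
    unfolding r_fun_def by (rule Least_le[of ?P, OF z(1)])
  ultimately show ?thesis
    using assms z(2)
    by (intro conjI initial_pair_if_coprime[where r = "r_fun lambda1 mu1"])
      (auto simp: coprime_iff_gcd_eq_1)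
qed

end
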